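(* For $0<t<1$ let $A(t)=(0,0,t)$, $B(t)=(t^2,t^2,t)$, $C(t)=(t^2,-t^2,t)$, $D_1(t)=(t^3,0,t)$, $D_2(t)=(-t^3,0,t)$, and for $i=1,2$ let $$X_i(t)=\overline{A(t)B(t)}\cup\overline{B(t)C(t)}\cup\overline{C(t)A(t)}\cup\overline{A(t)D_i(t)},\qquad X_i=\{0\}\cup\bigcup_{0<t<1}X_i(t)\subset\mathbb{R}^3,$$ where $\overline{PQ}$ denotes the line segment with endpoints $P,Q$. Then the surface germs $(X_1,0)$ and $(X_2,0)$ are ambient topologically equivalent and outer bi-Lipschitz equivalent, but not ambient bi-Lipschitz equivalent.
   Context: Germs $(X,0),(Y,0)\subset(\mathbb{R}^3,0)$ are: outer bi-Lipschitz equivalent if there are neighborhoods $U,V$ of $0$ and a homeomorphism $X\cap U\to Y\cap V$ sending $0$ to $0$ which is bi-Lipschitz for the Euclidean distance restricted to the sets; ambient bi-Lipschitz equivalent if there is a germ of bi-Lipschitz homeomorphism $(\mathbb{R}^3,0)\to(\mathbb{R}^3,0)$ sending $(X,0)$ to $(Y,0)$; ambient topologically equivalent if there is a germ of homeomorphism $(\mathbb{R}^3,0)\to(\mathbb{R}^3,0)$ sending $(X,0)$ to $(Y,0)$. *)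

theory Defs
  imports "HOL-Analysis.Analysis"
begin

definition bilipschitz_homeomorphism ::
    "'a::metric_space set \<Rightarrow> 'b::metric_space set \<Rightarrow> ('a \<Rightarrow> 'b) \<Rightarrow> ('b \<Rightarrow> 'a) \<Rightarrow> bool" where
  "bilipschitz_homeomorphism S T f g \<longleftrightarrow>
     homeomorphism S T f g \<and> (\<exists>K. K-lipschitz_on S f) \<and> (\<exists>L. L-lipschitz_on T g)"

text \<open>
  A germ at the origin is given by a representative set that contains the origin, and a germ of a
  map of the ambient space by a representative defined on an open neighbourhood \<open>U\<close> of the origin.
  That the map germ sends the germ of \<open>X\<close> to that of \<open>Y\<close> means \<open>h ` (X \<inter> U) = Y \<inter> V\<close>, after
  shrinking \<open>U\<close> and \<open>V\<close>.
\<close>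

definition outer_bilipschitz_equivalent :: "(real^3) set \<Rightarrow> (real^3) set \<Rightarrow> bool" where
  "outer_bilipschitz_equivalent X Y \<longleftrightarrow>
     (\<exists>U V f g. open U \<and> 0 \<in> U \<and> open V \<and> 0 \<in> V \<and>
        bilipschitz_homeomorphism (X \<inter> U) (Y \<inter> V) f g \<and> f 0 = 0)"

definition ambient_bilipschitz_equivalent :: "(real^3) set \<Rightarrow> (real^3) set \<Rightarrow> bool" where
  "ambient_bilipschitz_equivalent X Y \<longleftrightarrow>
     (\<exists>U V h k. open U \<and> 0 \<in> U \<and> open V \<and> 0 \<in> V \<and>
        bilipschitz_homeomorphism U V h k \<and> h 0 = 0 \<and> h ` (X \<inter> U) = Y \<inter> V)"

definition ambient_topologically_equivalent :: "(real^3) set \<Rightarrow> (real^3) set \<Rightarrow> bool" where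
  "ambient_topologically_equivalent X Y \<longleftrightarrow>
     (\<exists>U V h k. open U \<and> 0 \<in> U \<and> open V \<and> 0 \<in> V \<and>
        homeomorphism U V h k \<and> h 0 = 0 \<and> h ` (X \<inter> U) = Y \<inter> V)"

definition pt_A :: "real \<Rightarrow> real^3" where
  "pt_A t = vector [0, 0, t]"

definition pt_B :: "real \<Rightarrow> real^3" where
  "pt_B t = vector [t^2, t^2, t]"

definition pt_C :: "real \<Rightarrow> real^3" where
  "pt_C t = vector [t^2, - (t^2), t]"

definition pt_D1 :: "real \<Rightarrow> real^3" where
  "pt_D1 t = vector [t^3, 0, t]"

definition pt_D2 :: "real \<Rightarrow> real^3" where
  "pt_D2 t = vector [- (t^3), 0, t]"

definition slice :: "(real \<Rightarrow> real^3) \<Rightarrow> real \<Rightarrow> (real^3) set" where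
  "slice D t =
     closed_segment (pt_A t) (pt_B t) \<union> closed_segment (pt_B t) (pt_C t) \<union>
     closed_segment (pt_C t) (pt_A t) \<union> closed_segment (pt_A t) (D t)"

definition X1 :: "(real^3) set" where
  "X1 = {0} \<union> (\<Union>t\<in>{0<..<1}. slice pt_D1 t)"

definition X2 :: "(real^3) set" where
  "X2 = {0} \<union> (\<Union>t\<in>{0<..<1}. slice pt_D2 t)"

end

theory Submission imports Defs begin

text \<open>
  Both surfaces consist of the boundary of the solid horn \<open>\<bar>y\<bar> \<le> x \<le> z\<^sup>2\<close> and a hair attached to its
  edge \<open>x = y = 0\<close>, which lies inside the horn for \<open>X1\<close> and outside for \<open>X2\<close>. Reflecting the hair in
  \<open>x = 0\<close> is bi-Lipschitz on the surfaces. For the topological equivalence, a shear turns the solid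
  horn into an epigraph, and a piecewise linear reflection of the vertical lines in its graph
  exchanges inside and outside.
  An ambient bi-Lipschitz map cannot exchange them, since the inside of the horn within distance
  \<open>t\<close> of the origin is within order \<open>t\<^sup>2\<close> of the surface. Hence every point outside the horn and off
  the hair of \<open>X2\<close> would come from a point outside the horn of \<open>X1\<close>. The points of the former
  kind accumulate at all of \<open>X2\<close>, but those of the latter do not accumulate at the hair of \<open>X1\<close>.
\<close>

subsection \<open>The surfaces in coordinates\<close>

definition triangle_horn_boundary :: "(real^3) set" where
  "triangle_horn_boundary =
     {p. 0 \<le> p$3 \<and> \<bar>p$2\<bar> \<le> p$1 \<and> p$1 \<le> (p$3)^2 \<and> (p$1 = \<bar>p$2\<bar> \<or> p$1 = (p$3)^2)}"

section \<open>Coordinate descriptions of the segments and slices\<close>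

lemma mem_closed_segment_3:
  fixes p a b :: "real^3"
  shows "p \<in> closed_segment a b \<longleftrightarrow>
    (\<exists>u. 0 \<le> u \<and> u \<le> 1 \<and> p$1 = (1 - u) * a$1 + u * b$1 \<and> p$2 = (1 - u) * a$2 + u * b$2 \<and>
         p$3 = (1 - u) * a$3 + u * b$3)"
  by (simp add: in_segment vec_eq_iff forall_3)

lemma mem_AB:
  assumes "0 < t"
  shows "p \<in> closed_segment (pt_A t) (pt_B t) \<longleftrightarrow> p$3 = t \<and> p$2 = p$1 \<and> 0 \<le> p$1 \<and> p$1 \<le> t^2"
proof
  assume "p$3 = t \<and> p$2 = p$1 \<and> 0 \<le> p$1 \<and> p$1 \<le> t^2"
  with assms show "p \<in> closed_segment (pt_A t) (pt_B t)"
    unfolding mem_closed_segment_3 pt_A_def pt_B_def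
    by (intro exI[of _ "p$1 / t^2"]) (auto simp: vector_3 field_simps)
qed (auto simp: mem_closed_segment_3 pt_A_def pt_B_def vector_3 algebra_simps mult_left_le_one_le)

lemma mem_CA:
  assumes "0 < t"
  shows "p \<in> closed_segment (pt_C t) (pt_A t) \<longleftrightarrow> p$3 = t \<and> p$2 = - p$1 \<and> 0 \<le> p$1 \<and> p$1 \<le> t^2"
  unfolding closed_segment_commute[of "pt_C t"]
proof
  assume "p$3 = t \<and> p$2 = - p$1 \<and> 0 \<le> p$1 \<and> p$1 \<le> t^2"
  with assms show "p \<in> closed_segment (pt_A t) (pt_C t)"
    unfolding mem_closed_segment_3 pt_A_def pt_C_def
    by (intro exI[of _ "p$1 / t^2"]) (auto simp: vector_3 field_simps)
qed (auto simp: mem_closed_segment_3 pt_A_def pt_C_def vector_3 algebra_simps mult_left_le_one_le)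

lemma mem_BC:
  assumes "0 < t"
  shows "p \<in> closed_segment (pt_B t) (pt_C t) \<longleftrightarrow> p$3 = t \<and> p$1 = t^2 \<and> \<bar>p$2\<bar> \<le> t^2"
proof
  assume "p$3 = t \<and> p$1 = t^2 \<and> \<bar>p$2\<bar> \<le> t^2"
  with assms show "p \<in> closed_segment (pt_B t) (pt_C t)"
    unfolding mem_closed_segment_3 pt_B_def pt_C_def
    by (intro exI[of _ "(1 - p$2 / t^2) / 2"]) (auto simp: vector_3 field_simps abs_le_iff)
next
  assume "p \<in> closed_segment (pt_B t) (pt_C t)"
  then obtain u where u: "0 \<le> u" "u \<le> 1" "p$1 = t^2" "p$2 = (1 - 2 * u) * t^2" "p$3 = t"
    by (auto simp: mem_closed_segment_3 pt_B_def pt_C_def vector_3 algebra_simps)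
  then have "\<bar>p$2\<bar> = \<bar>1 - 2 * u\<bar> * t^2"
    by (simp add: abs_mult)
  also have "\<dots> \<le> 1 * t^2"
    using u by (intro mult_right_mono) auto
  finally show "p$3 = t \<and> p$1 = t^2 \<and> \<bar>p$2\<bar> \<le> t^2"
    using u by simp
qed

lemma mem_AD1:
  assumes "0 < t"
  shows "p \<in> closed_segment (pt_A t) (pt_D1 t) \<longleftrightarrow> p$3 = t \<and> p$2 = 0 \<and> 0 \<le> p$1 \<and> p$1 \<le> t^3"
proof
  assume "p$3 = t \<and> p$2 = 0 \<and> 0 \<le> p$1 \<and> p$1 \<le> t^3"
  with assms show "p \<in> closed_segment (pt_A t) (pt_D1 t)"
    unfolding mem_closed_segment_3 pt_A_def pt_D1_def
    by (intro exI[of _ "p$1 / t^3"]) (auto simp: vector_3 field_simps)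
qed (use assms in \<open>auto simp: mem_closed_segment_3 pt_A_def pt_D1_def vector_3 algebra_simps mult_left_le_one_le\<close>)

lemma mem_AD2:
  assumes "0 < t"
  shows "p \<in> closed_segment (pt_A t) (pt_D2 t) \<longleftrightarrow> p$3 = t \<and> p$2 = 0 \<and> - (t^3) \<le> p$1 \<and> p$1 \<le> 0"
proof
  assume "p$3 = t \<and> p$2 = 0 \<and> - (t^3) \<le> p$1 \<and> p$1 \<le> 0"
  with assms show "p \<in> closed_segment (pt_A t) (pt_D2 t)"
    unfolding mem_closed_segment_3 pt_A_def pt_D2_def
    by (intro exI[of _ "- p$1 / t^3"]) (auto simp: vector_3 field_simps)
qed (use assms in \<open>auto simp: mem_closed_segment_3 pt_A_def pt_D2_def vector_3 algebra_simps mult_left_le_one_le\<close>)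

lemma mem_slice_D1:
  assumes "0 < t"
  shows "p \<in> slice pt_D1 t \<longleftrightarrow>
    p$3 = t \<and> (p \<in> triangle_horn_boundary \<or> p$2 = 0 \<and> 0 \<le> p$1 \<and> p$1 \<le> t^3)"
  using assms by (auto simp: slice_def mem_AB mem_BC mem_CA mem_AD1 triangle_horn_boundary_def)

lemma mem_slice_D2:
  assumes "0 < t"
  shows "p \<in> slice pt_D2 t \<longleftrightarrow>
    p$3 = t \<and> (p \<in> triangle_horn_boundary \<or> p$2 = 0 \<and> - (t^3) \<le> p$1 \<and> p$1 \<le> 0)"
  using assms by (auto simp: slice_def mem_AB mem_BC mem_CA mem_AD2 triangle_horn_boundary_def)

lemma eq_0_real3_iff: "(p :: real^3) = 0 \<longleftrightarrow> p$1 = 0 \<and> p$2 = 0 \<and> p$3 = 0"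
  by (simp add: vec_eq_iff forall_3)

text \<open>Allowing height 0 absorbs the separately added origin, because each alternative forces
  \<open>p = 0\<close> there.\<close>

lemma mem_X1:
  "p \<in> X1 \<longleftrightarrow> 0 \<le> p$3 \<and> p$3 < 1 \<and>
     (p \<in> triangle_horn_boundary \<or> p$2 = 0 \<and> 0 \<le> p$1 \<and> p$1 \<le> (p$3)^3)"
  by (cases "p$3 = 0") (auto simp: X1_def mem_slice_D1 eq_0_real3_iff triangle_horn_boundary_def)

lemma mem_X2:
  "p \<in> X2 \<longleftrightarrow> 0 \<le> p$3 \<and> p$3 < 1 \<and>
     (p \<in> triangle_horn_boundary \<or> p$2 = 0 \<and> - ((p$3)^3) \<le> p$1 \<and> p$1 \<le> 0)"
  by (cases "p$3 = 0") (auto simp: X2_def mem_slice_D2 eq_0_real3_iff triangle_horn_boundary_def)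

subsection \<open>Outer bi-Lipschitz equivalence\<close>

text \<open>A whole strip around the axis is reflected rather than one hair, which makes the map an
  involution serving both directions.\<close>

definition reflect_hair :: "real^3 \<Rightarrow> real^3" where
  "reflect_hair p = (if p$2 = 0 \<and> \<bar>p$1\<bar> \<le> \<bar>p$3\<bar>^3 then vector [- p$1, 0, p$3] else p)"

lemma reflect_hair_3 [simp]: "reflect_hair p $ 3 = p $ 3"
  by (simp add: reflect_hair_def)

lemma reflect_hair_involution [simp]: "reflect_hair (reflect_hair p) = p"
  by (auto simp: reflect_hair_def vec_eq_iff forall_3)

text \<open>Keeps the reflected strip off the face \<open>x = z^2\<close> at these heights, so that
  it meets the horn boundary only on the axis.\<close>

lemma cube_less_square:
  fixes z :: real
  assumes "0 < z" "z < 1/4"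
  shows "z^3 < z^2 / 4"
  using assms by (simp add: power3_eq_cube power2_eq_square)

lemma reflect_hair_X1:
  assumes "p \<in> X1" "p$3 < 1/4"
  shows "reflect_hair p \<in> X2"
proof (cases "p$3 = 0")
  case False
  with assms have "0 < p$3"
    by (auto simp: mem_X1)
  with assms cube_less_square[of "p$3"] show ?thesis
    by (auto simp: mem_X1 mem_X2 reflect_hair_def triangle_horn_boundary_def)
qed (use assms in \<open>auto simp: mem_X1 mem_X2 reflect_hair_def triangle_horn_boundary_def\<close>)

lemma reflect_hair_X2:
  assumes "p \<in> X2" "p$3 < 1/4"
  shows "reflect_hair p \<in> X1"
proof (cases "p$3 = 0")
  case False
  with assms have "0 < p$3"
    by (auto simp: mem_X2)
  with assms cube_less_square[of "p$3"] show ?thesis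
    by (auto simp: mem_X1 mem_X2 reflect_hair_def triangle_horn_boundary_def)
qed (use assms in \<open>auto simp: mem_X1 mem_X2 reflect_hair_def triangle_horn_boundary_def\<close>)

section \<open>Lipschitz estimate for the hair reflection\<close>

lemma component_le_dist: "\<bar>(p::real^3)$i - q$i\<bar> \<le> dist p q"
  using component_le_norm_cart[of "p - q" i] by (simp add: dist_norm)

lemma norm_real3_le: "norm (p::real^3) \<le> \<bar>p$1\<bar> + \<bar>p$2\<bar> + \<bar>p$3\<bar>"
  using norm_le_l1_cart[of p] by (simp add: sum_3)

text \<open>Controls how far the reflection moves \<open>p\<close>. For \<open>p$1 > 0\<close>, a
  point of the side faces satisfies \<open>p$1 \<le> |p$1 - q$1| + |q$2|\<close>, and a point of the
  face \<open>x = z^2\<close> is either far away in \<open>x\<close> or noticeably lower than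
  \<open>p\<close>.\<close>

lemma hair_le_dist:
  assumes p: "p \<in> X1 \<or> p \<in> X2" "p$3 < 1/4" "p$2 = 0" "\<bar>p$1\<bar> \<le> \<bar>p$3\<bar>^3"
    and q: "q \<in> triangle_horn_boundary"
  shows "\<bar>p$1\<bar> \<le> 2 * dist p q"
proof (cases "p$1 \<le> 0")
  case True
  moreover have "0 \<le> q$1"
    using q by (auto simp: triangle_horn_boundary_def)
  ultimately show ?thesis
    using component_le_dist[of p 1 q] by simp
next
  case False
  note c = component_le_dist[of p 1 q] component_le_dist[of p 2 q] component_le_dist[of p 3 q]
  have z: "0 < p$3"
  proof -
    have "p$3 \<noteq> 0"
      using p False by auto
    with p show ?thesis
      by (auto simp: mem_X1 mem_X2)
  qed
  have a: "p$1 \<le> (p$3)^3" "0 < p$1"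
    using p False z by auto
  show ?thesis
  proof (cases "q$1 = \<bar>q$2\<bar>")
    case True
    then show ?thesis
      using c p by linarith
  next
    case False
    then have q1: "q$1 = (q$3)^2" "0 \<le> q$3"
      using q by (auto simp: triangle_horn_boundary_def)
    show ?thesis
    proof (cases "2 * p$1 \<le> q$1")
      case True
      then show ?thesis
        using c a by linarith
    next
      case False
      \<comment> \<open>Otherwise \<open>p$3 < 1/4\<close> gives
        \<open>q$3 \<ge> 15/16 * p$3\<close>, so \<open>q$1\<close> is at least
        \<open>225/256 * (p$3)^2\<close>, contradicting
        \<open>q$1 < 2 * p$1 < (p$3)^2 / 2\<close>.\<close>
      have "p$3 - q$3 \<ge> (p$3)^3"
      proof (rule ccontr)
        assume "\<not> ?thesis"
        then have "q$3 > p$3 - (p$3)^3"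
          by simp
        moreover have "(p$3)^3 \<le> p$3 / 16"
        proof -
          have "(p$3)^2 \<le> (1/4)^2"
            using z p by (intro power_mono) auto
          then have "p$3 * (p$3)^2 \<le> p$3 * (1/16)"
            using z by (intro mult_left_mono) (auto simp: power2_eq_square)
          then show ?thesis
            by (simp add: power3_eq_cube power2_eq_square)
        qed
        ultimately have "15/16 * p$3 \<le> q$3"
          by simp
        then have "(15/16 * p$3)^2 \<le> (q$3)^2"
          using z by (intro power_mono) auto
        then have "225/256 * (p$3)^2 \<le> q$1"
          by (simp add: q1 power_mult_distrib power2_eq_square)
        moreover have "q$1 < (p$3)^2 / 2"
          using False a cube_less_square[of "p$3"] z p by linarith
        moreover have "0 < (p$3)^2"
          using z by simp
        ultimately show False
          by linarith
      qed
      then show ?thesis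
        using c a by linarith
    qed
  qed
qed

text \<open>The constant is \<open>4 + 1\<close>: the reflection moves \<open>p\<close> by
  \<open>2 * |p$1|\<close>, at most \<open>4 * dist p q\<close>, and the triangle inequality adds
  \<open>dist p q\<close>.\<close>

lemma reflect_hair_lipschitz_aux:
  assumes p: "p \<in> X1 \<or> p \<in> X2" "p$3 < 1/4" "p$2 = 0" "\<bar>p$1\<bar> \<le> \<bar>p$3\<bar>^3"
    and q: "q \<in> triangle_horn_boundary" "reflect_hair q = q"
  shows "dist (reflect_hair p) (reflect_hair q) \<le> 5 * dist p q"
proof -
  have "dist (reflect_hair p) p = norm (vector [- 2 * p$1, 0, 0] :: real^3)"
    using p by (auto simp: dist_norm reflect_hair_def vec_eq_iff forall_3 intro!: arg_cong[where f = norm])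
  also have "\<dots> \<le> 2 * \<bar>p$1\<bar>"
    using norm_real3_le[of "vector [- 2 * p$1, 0, 0] :: real^3"] by simp
  also have "\<dots> \<le> 4 * dist p q"
    using hair_le_dist[OF p q(1)] by simp
  finally show ?thesis
    using dist_triangle[of "reflect_hair p" q p] q by simp
qed

lemma reflect_hair_lipschitz:
  assumes X: "X = X1 \<or> X = X2"
  shows "5-lipschitz_on (X \<inter> {p. p$3 < 1/4}) reflect_hair"
proof (rule lipschitz_onI)
  fix p q
  assume p: "p \<in> X \<inter> {p. p$3 < 1/4}" and q: "q \<in> X \<inter> {p. p$3 < 1/4}"
  \<comment> \<open>On \<open>?H\<close> the map is a linear isometry and off \<open>?H\<close> it
    is the identity, so only mixed pairs need the estimate.\<close>
  let ?H = "{p :: real^3. p$2 = 0 \<and> \<bar>p$1\<bar> \<le> \<bar>p$3\<bar>^3}"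
  have out: "r \<in> triangle_horn_boundary" "reflect_hair r = r" if "r \<in> X" "r \<notin> ?H" for r
    using that X by (auto simp: mem_X1 mem_X2 reflect_hair_def)
  have "dist (reflect_hair p) (reflect_hair q) = dist p q" if "p \<in> ?H" "q \<in> ?H"
    using that by (simp add: reflect_hair_def dist_vec_def L2_set_def sum_3 dist_real_def power2_commute)
  moreover have "dist (reflect_hair p) (reflect_hair q) \<le> 5 * dist p q" if "p \<in> ?H" "q \<notin> ?H"
    using that p q X out by (intro reflect_hair_lipschitz_aux) auto
  moreover have "dist (reflect_hair q) (reflect_hair p) \<le> 5 * dist q p" if "q \<in> ?H" "p \<notin> ?H"
    using that p q X out by (intro reflect_hair_lipschitz_aux) auto
  moreover have "dist (reflect_hair p) (reflect_hair q) = dist p q" if "p \<notin> ?H" "q \<notin> ?H"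
    using that p q out by auto
  moreover have "0 \<le> dist p q"
    by simp
  ultimately show "dist (reflect_hair p) (reflect_hair q) \<le> 5 * dist p q"
    by (smt (verit) dist_commute)
qed simp

lemma X1_outer_bilipschitz_equivalent_X2: "outer_bilipschitz_equivalent X1 X2"
proof -
  define U :: "(real^3) set" where "U = {p. p$3 < 1/4}"
  have "open U"
    unfolding U_def by (intro open_Collect_less continuous_intros)
  note lip = reflect_hair_lipschitz[of X1] reflect_hair_lipschitz[of X2]
  have "homeomorphism (X1 \<inter> U) (X2 \<inter> U) reflect_hair reflect_hair"
    using lip[THEN lipschitz_on_continuous_on] reflect_hair_X1 reflect_hair_X2
    by (intro homeomorphismI) (auto simp: U_def)
  then have "bilipschitz_homeomorphism (X1 \<inter> U) (X2 \<inter> U) reflect_hair reflect_hair"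
    using lip by (auto simp: bilipschitz_homeomorphism_def U_def)
  moreover have "reflect_hair 0 = 0" "0 \<in> U"
    by (auto simp: reflect_hair_def vec_eq_iff forall_3 U_def)
  ultimately show ?thesis
    unfolding outer_bilipschitz_equivalent_def using \<open>open U\<close> by blast
qed

subsection \<open>Ambient topological equivalence\<close>

text \<open>
  In the coordinate \<open>u = x - 2 z\<^sup>3\<close> the solid horn near \<open>0\<close> is an epigraph \<open>z \<ge> horn_height u y\<close>. The axis
  is \<open>u = - 2 z\<^sup>3\<close> and the ends of the hairs are \<open>u = - z\<^sup>3\<close> and \<open>u = - 3 z\<^sup>3\<close>, so that on the line
  of fixed \<open>u\<close> the three heights have constant ratios.
  The right edge \<open>x = z\<^sup>2\<close> becomes \<open>u = right_edge z\<close>; only its values on \<open>[0, 1/6]\<close> matter,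
  and outside it is continued to an increasing bijection of the line.
\<close>

definition right_edge :: "real \<Rightarrow> real" where
  "right_edge z = (if z \<le> 0 then z else if z \<le> 1/6 then z^2 - 2 * z^3 else z - 4/27)"

text \<open>The shift \<open>4/27\<close> makes the linear piece meet the cubic one at
  \<open>1/6\<close>, where both equal \<open>1/54\<close>.\<close>

lemma right_edge_high:
  assumes "1/6 \<le> z"
  shows "right_edge z = z - 4/27"
proof (cases "z = 1/6")
  case True
  show ?thesis
    unfolding True right_edge_def by (simp add: power2_eq_square power3_eq_cube)
qed (use assms in \<open>auto simp: right_edge_def\<close>)

lemma continuous_right_edge: "continuous_on UNIV right_edge"
proof -
  have "continuous_on {..0} right_edge"
    by (rule continuous_on_eq[OF continuous_on_id]) (simp add: right_edge_def)
  moreover have "continuous_on {0..1/6} right_edge"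
    by (rule continuous_on_eq[where f = "\<lambda>z. z^2 - 2 * z^3"])
      (auto simp: right_edge_def intro!: continuous_intros)
  moreover have "continuous_on {1/6..} right_edge"
    by (rule continuous_on_eq[where f = "\<lambda>z. z - 4/27"])
      (auto simp: right_edge_high intro!: continuous_intros)
  ultimately have "continuous_on ({..0} \<union> ({0..1/6} \<union> {1/6..})) right_edge"
    by (intro continuous_on_closed_Un closed_Un) auto
  moreover have "{..0} \<union> ({0..1/6} \<union> {1/6..}) = (UNIV :: real set)"
    by auto
  ultimately show ?thesis
    by simp
qed

lemma strict_mono_right_edge: "strict_mono right_edge"
proof (rule strict_monoI)
  fix a b :: real
  assume ab: "a < b"
  \<comment> \<open>The difference of the cubic values factors with \<open>y - x\<close>. On
    \<open>[0, 1/6]\<close> the products in the cofactor are bounded by linear terms, so the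
    cofactor is positive.\<close>
  have mid: "right_edge x < right_edge y" if "0 \<le> x" "x < y" "y \<le> 1/6" for x y
  proof -
    have "x * x \<le> x / 6" "x * y \<le> x / 6" "y * y \<le> y / 6"
      using that mult_left_mono[of x "1/6" x] mult_left_mono[of y "1/6" x]
        mult_left_mono[of y "1/6" y] by simp_all
    then have "x^2 + x * y + y^2 \<le> x / 6 + x / 6 + y / 6"
      unfolding power2_eq_square by (intro add_mono)
    also have "\<dots> < (x + y) / 2"
      using that by simp
    finally have "0 < (y - x) * (x + y - 2 * (x^2 + x * y + y^2))"
      using that by simp
    also have "\<dots> = y^2 - 2 * y^3 - (x^2 - 2 * x^3)"
      by (simp add: algebra_simps power2_eq_square power3_eq_cube)
    finally show ?thesis
      using that by (auto simp: right_edge_def)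
  qed
  have low: "right_edge x < right_edge y" if "x < y" "y \<le> 0" for x y
    using that by (auto simp: right_edge_def)
  have high: "right_edge x < right_edge y" if "x < y" "1/6 \<le> x" for x y
    using that by (simp add: right_edge_high)
  consider "b \<le> 0" | "1/6 \<le> a" | "0 \<le> a" "b \<le> 1/6" | "a < 0" "0 < b" "b \<le> 1/6"
    | "0 \<le> a" "a < 1/6" "1/6 < b" | "a < 0" "1/6 < b"
    by linarith
  then show "right_edge a < right_edge b"
  proof cases
    case 4
    then show ?thesis
      using low[of a 0] mid[of 0 b] by simp
  next
    case 5
    then show ?thesis
      using mid[of a "1/6"] high[of "1/6" b] by simp
  next
    case 6
    then show ?thesis
      using low[of a 0] mid[of 0 "1/6"] high[of "1/6" b] by simp
  qed (use ab low mid high in auto)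
qed

lemma right_edge_inv: "right_edge (inv right_edge u) = u" "inv right_edge (right_edge z) = z"
proof -
  have "\<exists>z. right_edge z = u"
  proof -
    \<comment> \<open>Both ends of the bracket lie on linear pieces, and the added 1 outweighs the
      shift \<open>4/27\<close>.\<close>
    have "right_edge (- \<bar>u\<bar>) \<le> u" "u \<le> right_edge (\<bar>u\<bar> + 1)"
      by (auto simp: right_edge_def)
    then show ?thesis
      using IVT'[of right_edge "- \<bar>u\<bar>" u "\<bar>u\<bar> + 1"] continuous_on_subset[OF continuous_right_edge]
      by auto
  qed
  then show "right_edge (inv right_edge u) = u"
    by (intro f_inv_into_f) auto
  show "inv right_edge (right_edge z) = z"
    using strict_mono_right_edge strict_mono_imp_inj_on by (intro inv_f_f) auto
qed

lemma inv_right_edge_le_iff: "inv right_edge u \<le> z \<longleftrightarrow> u \<le> right_edge z"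
  using strict_mono_less_eq[OF strict_mono_right_edge, of "inv right_edge u" z]
  by (simp add: right_edge_inv)

lemma continuous_inv_right_edge: "continuous_on UNIV (inv right_edge)"
proof -
  have "isCont (inv right_edge) (right_edge z)" for z
    by (rule isCont_inverse_function[of 1])
      (use continuous_right_edge in \<open>auto simp: right_edge_inv continuous_on_eq_continuous_at\<close>)
  then have "isCont (inv right_edge) u" for u
    using right_edge_inv(1)[of u] by metis
  then show ?thesis
    by (simp add: continuous_on_eq_continuous_at)
qed

text \<open>Each of the conditions \<open>|y| \<le> x\<close> and \<open>x \<le> z^2\<close> is
  solved for the height at fixed \<open>u\<close>; the maximum is the lowest height at which both
  hold.\<close>

definition horn_height :: "real \<Rightarrow> real \<Rightarrow> real" where
  "horn_height u y = max (root 3 ((\<bar>y\<bar> - u) / 2)) (inv right_edge u)"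

lemma root3_le_iff: "root 3 a \<le> z \<longleftrightarrow> a \<le> z^3"
  using real_root_le_iff[of 3 a "z^3"] odd_real_root_power_cancel[of 3 z] by simp

lemma horn_height_eq:
  "horn_height u y = z \<longleftrightarrow>
    \<bar>y\<bar> \<le> u + 2 * z^3 \<and> u \<le> right_edge z \<and> (\<bar>y\<bar> = u + 2 * z^3 \<or> u = right_edge z)"
proof -
  have "root 3 a = z \<longleftrightarrow> a = z^3" for a
    using odd_real_root_power_cancel[of 3 z] odd_real_root_pow[of 3 a] by auto
  moreover have "inv right_edge u = z \<longleftrightarrow> u = right_edge z"
    using right_edge_inv by metis
  moreover have "max a b = z \<longleftrightarrow> a \<le> z \<and> b \<le> z \<and> (a = z \<or> b = z)" for a b :: real
    by linarith
  ultimately show ?thesis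
    unfolding horn_height_def by (auto simp: inv_right_edge_le_iff root3_le_iff)
qed

text \<open>For negative \<open>u\<close> the right edge is no constraint at positive heights, so
  the graph passes through the axis point.\<close>

lemma horn_height_hair:
  assumes "u = - 2 * r^3" "0 < r"
  shows "horn_height u 0 = r"
proof -
  have "u \<le> right_edge 0" "right_edge 0 \<le> right_edge r"
    using assms strict_mono_less_eq[OF strict_mono_right_edge, of 0 r] by (auto simp: right_edge_def)
  then show ?thesis
    using assms by (simp add: horn_height_eq)
qed

text \<open>
  The slope is the ratio of the height ranges of the two hairs over a fixed \<open>u < 0\<close>.
\<close>

definition hair_slope :: real where
  "hair_slope = (1 - root 3 (2/3)) / (root 3 2 - 1)"

lemma hair_slope_pos: "0 < hair_slope"
  by (simp add: hair_slope_def)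

lemma hair_slope_mult: "hair_slope * (root 3 2 - 1) = 1 - root 3 (2/3)"
  by (simp add: hair_slope_def)

text \<open>Reverses the line about 0; the reciprocal slopes on the two sides make it an
  involution.\<close>

definition fold_height :: "real \<Rightarrow> real" where
  "fold_height w = - hair_slope * max w 0 - min w 0 / hair_slope"

lemma fold_height_involution [simp]: "fold_height (fold_height w) = w"
proof (cases "0 \<le> w")
  case True
  then have "fold_height w = - hair_slope * w" "- hair_slope * w \<le> 0"
    using hair_slope_pos by (auto simp: fold_height_def)
  then show ?thesis
    using hair_slope_pos by (simp add: fold_height_def)
next
  case False
  then have "fold_height w = - w / hair_slope" "0 \<le> - w / hair_slope"
    using hair_slope_pos by (auto simp: fold_height_def divide_le_0_iff)
  then show ?thesis
    using hair_slope_pos by (simp add: fold_height_def)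
qed

section \<open>The homeomorphism exchanging the inside and the outside of the horn\<close>

definition shear :: "real^3 \<Rightarrow> real" where
  "shear p = p$1 - 2 * (p$3)^3"

definition swap_height :: "real^3 \<Rightarrow> real" where
  "swap_height p =
     horn_height (shear p) (p$2) + fold_height (p$3 - horn_height (shear p) (p$2))"

text \<open>The fold acts along lines of fixed \<open>u\<close> and \<open>y\<close>; the first
  coordinate is recovered from \<open>u\<close> and the new height.\<close>

definition swap_horn :: "real^3 \<Rightarrow> real^3" where
  "swap_horn p = vector [shear p + 2 * (swap_height p)^3, p$2, swap_height p]"

lemma swap_horn_nth [simp]:
  "swap_horn p $ 1 = shear p + 2 * (swap_height p)^3"
  "swap_horn p $ 2 = p$2"
  "swap_horn p $ 3 = swap_height p"
  by (simp_all add: swap_horn_def)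

lemma swap_horn_involution [simp]: "swap_horn (swap_horn p) = p"
proof -
  have "shear (swap_horn p) = shear p"
    by (simp add: shear_def[of "swap_horn p"])
  moreover from this have "swap_height (swap_horn p) = p$3"
    by (simp add: swap_height_def)
  ultimately show ?thesis
    by (simp add: vec_eq_iff forall_3 shear_def[of p])
qed

lemma continuous_vector3:
  fixes f g h :: "'a::topological_space \<Rightarrow> real"
  assumes "continuous_on S f" "continuous_on S g" "continuous_on S h"
  shows "continuous_on S (\<lambda>x. vector [f x, g x, h x] :: real^3)"
proof -
  have "continuous_on S (\<lambda>x. (vector [f x, g x, h x] :: real^3) $ i)" for i
    using assms exhaust_3[of i] by auto
  then have "continuous_on S (\<lambda>x. \<chi> i. (vector [f x, g x, h x] :: real^3) $ i)"
    by (rule continuous_on_vec_lambda)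
  then show ?thesis
    by simp
qed

lemma continuous_swap_horn: "continuous_on UNIV swap_horn"
proof -
  have shear: "continuous_on UNIV shear"
    unfolding shear_def by (intro continuous_intros)
  have "continuous_on UNIV (\<lambda>p. horn_height (shear p) (p$2))"
    unfolding horn_height_def
    by (intro continuous_intros shear continuous_on_compose2[OF continuous_inv_right_edge]) auto
  then have "continuous_on UNIV swap_height"
    unfolding swap_height_def fold_height_def using hair_slope_pos
    by (intro continuous_intros) auto
  with shear show ?thesis
    unfolding swap_horn_def by (intro continuous_vector3 continuous_intros)
qed

text \<open>Such points lie on the graph of \<open>horn_height\<close>, which the fold fixes. Below
  height \<open>1/6\<close> the function \<open>right_edge\<close> is the true edge.\<close>

lemma swap_horn_boundary:
  assumes "p \<in> triangle_horn_boundary" "p$3 < 1/6"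
  shows "swap_horn p = p"
proof -
  have "horn_height (shear p) (p$2) = p$3"
    unfolding horn_height_eq
    using assms by (auto simp: triangle_horn_boundary_def right_edge_def shear_def)
  then show ?thesis
    by (simp add: vec_eq_iff forall_3 swap_height_def fold_height_def shear_def)
qed

lemma hair_swap_height:
  assumes "p$2 = 0" "0 < r" "p$1 = 2 * (p$3)^3 - 2 * r^3"
  shows "swap_height p = r + fold_height (p$3 - r)" "shear p = - 2 * r^3"
proof -
  show "shear p = - 2 * r^3"
    using assms by (simp add: shear_def)
  then show "swap_height p = r + fold_height (p$3 - r)"
    using horn_height_hair[of "shear p" r] assms by (simp add: swap_height_def)
qed

text \<open>On the line \<open>u = - 2 * r^3\<close>, \<open>y = 0\<close> the inner hair fills the
  heights from \<open>r\<close> to \<open>root 3 2 * r\<close>, and the fold carries them into the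
  range from \<open>root 3 (2/3) * r\<close> to \<open>r\<close> of the outer hair.\<close>

lemma swap_horn_hair1:
  assumes p: "p$2 = 0" "0 \<le> p$1" "p$1 \<le> (p$3)^3" "0 < p$3"
  shows "0 < swap_horn p $ 3" "- ((swap_horn p $ 3)^3) \<le> swap_horn p $ 1" "swap_horn p $ 1 \<le> 0"
proof -
  \<comment> \<open>The height of the axis point with the same \<open>u\<close>.\<close>
  define r where "r = root 3 ((p$3)^3 - p$1 / 2)"
  have z3: "0 < (p$3)^3"
    using p by simp
  have pos: "0 < (p$3)^3 - p$1 / 2"
    using p z3 by linarith
  have r: "0 < r" "p$1 = 2 * (p$3)^3 - 2 * r^3"
    using pos by (simp_all add: r_def odd_real_root_pow)
  note sw = hair_swap_height[OF p(1) r]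
  have "r^3 \<le> (p$3)^3" "(p$3)^3 \<le> (root 3 2 * r)^3"
    using r p by (auto simp: power_mult_distrib)
  then have z: "r \<le> p$3" "p$3 \<le> root 3 2 * r"
    using p r power_mono_iff[of r "p$3" 3] power_mono_iff[of "p$3" "root 3 2 * r" 3] by auto
  have s: "swap_height p = r - hair_slope * (p$3 - r)"
    using z by (simp add: sw fold_height_def)
  have "hair_slope * (p$3 - r) \<le> hair_slope * ((root 3 2 - 1) * r)"
    using z hair_slope_pos by (intro mult_left_mono) (auto simp: algebra_simps)
  also have "\<dots> = (1 - root 3 (2/3)) * r"
    by (metis hair_slope_mult mult.assoc)
  finally have "root 3 (2/3) * r \<le> swap_height p"
    by (simp add: s algebra_simps)
  moreover have b: "0 < root 3 (2/3) * r"
    using r by simp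
  ultimately have "(root 3 (2/3) * r)^3 \<le> (swap_height p)^3" "0 < swap_height p"
    by (auto intro!: power_mono)
  moreover have "swap_height p \<le> r"
    using z hair_slope_pos by (simp add: s)
  ultimately show "0 < swap_horn p $ 3" "- ((swap_horn p $ 3)^3) \<le> swap_horn p $ 1"
    "swap_horn p $ 1 \<le> 0"
    using power_mono[of "swap_height p" r 3] by (auto simp: sw(2) power_mult_distrib)
qed

text \<open>The same two height ranges, traversed backwards with the reciprocal slope.\<close>

lemma swap_horn_hair2:
  assumes p: "p$2 = 0" "- ((p$3)^3) \<le> p$1" "p$1 \<le> 0" "0 < p$3"
  shows "0 < swap_horn p $ 3" "0 \<le> swap_horn p $ 1" "swap_horn p $ 1 \<le> (swap_horn p $ 3)^3"
proof -
  define r where "r = root 3 ((p$3)^3 - p$1 / 2)"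
  have z3: "0 < (p$3)^3"
    using p by simp
  have pos: "0 < (p$3)^3 - p$1 / 2"
    using p z3 by linarith
  have r: "0 < r" "p$1 = 2 * (p$3)^3 - 2 * r^3"
    using pos by (simp_all add: r_def odd_real_root_pow)
  note sw = hair_swap_height[OF p(1) r]
  have "(p$3)^3 \<le> r^3" "(root 3 (2/3) * r)^3 \<le> (p$3)^3"
    using r p by (auto simp: power_mult_distrib)
  then have z: "p$3 \<le> r" "root 3 (2/3) * r \<le> p$3"
    using p r power_mono_iff[of "p$3" r 3] power_mono_iff[of "root 3 (2/3) * r" "p$3" 3] by auto
  have s: "swap_height p = r + (r - p$3) / hair_slope"
    using z by (simp add: sw fold_height_def diff_divide_distrib)
  have "r - p$3 \<le> (1 - root 3 (2/3)) * r"
    using z by (simp add: algebra_simps)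
  also have "\<dots> = hair_slope * ((root 3 2 - 1) * r)"
    by (metis hair_slope_mult mult.assoc)
  finally have "(r - p$3) / hair_slope \<le> (root 3 2 - 1) * r"
    using hair_slope_pos by (simp add: field_simps)
  then have "swap_height p \<le> root 3 2 * r"
    by (simp add: s algebra_simps)
  moreover have "r \<le> swap_height p"
    using z hair_slope_pos by (simp add: s)
  ultimately show "0 < swap_horn p $ 3" "0 \<le> swap_horn p $ 1"
    "swap_horn p $ 1 \<le> (swap_horn p $ 3)^3"
    using power_mono[of r "swap_height p" 3] power_mono[of "swap_height p" "root 3 2 * r" 3] r(1)
    by (auto simp: sw(2) power_mult_distrib)
qed

lemma swap_horn_X1:
  assumes "p \<in> X1" "p$3 < 1/6" "swap_horn p $ 3 < 1"
  shows "swap_horn p \<in> X2"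
proof (cases "p \<in> triangle_horn_boundary")
  case True
  then show ?thesis
    using assms swap_horn_boundary[OF True] by (auto simp: mem_X1 mem_X2)
next
  case False
  then have p: "p$2 = 0" "0 \<le> p$1" "p$1 \<le> (p$3)^3" "0 \<le> p$3" "p$3 \<noteq> 0"
    using assms by (auto simp: mem_X1 triangle_horn_boundary_def)
  then show ?thesis
    using swap_horn_hair1[of p] assms by (auto simp: mem_X2)
qed

lemma swap_horn_X2:
  assumes "p \<in> X2" "p$3 < 1/6" "swap_horn p $ 3 < 1"
  shows "swap_horn p \<in> X1"
proof (cases "p \<in> triangle_horn_boundary")
  case True
  then show ?thesis
    using assms swap_horn_boundary[OF True] by (auto simp: mem_X1 mem_X2)
next
  case False
  then have p: "p$2 = 0" "- ((p$3)^3) \<le> p$1" "p$1 \<le> 0" "0 \<le> p$3" "p$3 \<noteq> 0"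
    using assms by (auto simp: mem_X2 triangle_horn_boundary_def)
  then show ?thesis
    using swap_horn_hair2[of p] assms by (auto simp: mem_X1)
qed

lemma X1_ambient_topologically_equivalent_X2: "ambient_topologically_equivalent X1 X2"
proof -
  \<comment> \<open>Intersecting with the preimage makes the neighborhood invariant under the
    involution.\<close>
  define U where "U = {p :: real^3. p$3 < 1/6} \<inter> {p. swap_horn p $ 3 < 1/6}"
  have "open U"
    unfolding U_def
    by (intro open_Int open_Collect_less continuous_intros continuous_on_component
        continuous_swap_horn)
  have "swap_horn 0 = 0"
    by (rule swap_horn_boundary) (auto simp: triangle_horn_boundary_def)
  then have "0 \<in> U"
    by (simp add: U_def del: swap_horn_nth)
  have U: "swap_horn p \<in> U" if "p \<in> U" for p
    using that by (simp add: U_def del: swap_horn_nth)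
  then have "homeomorphism U U swap_horn swap_horn"
    using continuous_on_subset[OF continuous_swap_horn] by (intro homeomorphismI) auto
  moreover have "swap_horn ` (X1 \<inter> U) = X2 \<inter> U"
  proof (intro equalityI subsetI)
    fix p assume "p \<in> X2 \<inter> U"
    then have "swap_horn p \<in> X1 \<inter> U"
      using U swap_horn_X2[of p] by (auto simp: U_def)
    then show "p \<in> swap_horn ` (X1 \<inter> U)"
      by (metis imageI swap_horn_involution)
  qed (use U swap_horn_X1 in \<open>auto simp: U_def\<close>)
  ultimately show ?thesis
    unfolding ambient_topologically_equivalent_def
    using \<open>open U\<close> \<open>0 \<in> U\<close> \<open>swap_horn 0 = 0\<close> by blast
qed

subsection \<open>Ambient bi-Lipschitz inequivalence\<close>

text \<open>The slice of \<open>X2\<close> with its triangle filled in. It is star-shaped about the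
  axis point, so points outside it can be pushed outwards radially without meeting
  \<open>X2\<close>.\<close>

definition solid_slice2 :: "real \<Rightarrow> (real^3) set" where
  "solid_slice2 t = {p. p$3 = t \<and> (\<bar>p$2\<bar> \<le> p$1 \<and> p$1 \<le> t^2 \<or> p$2 = 0 \<and> - (t^3) \<le> p$1 \<and> p$1 \<le> 0)}"

lemma X2_subset_solid_slice2: "p \<in> X2 \<Longrightarrow> p \<in> solid_slice2 (p$3)"
  by (auto simp: mem_X2 solid_slice2_def triangle_horn_boundary_def)

lemma solid_slice2_shrink:
  assumes "p \<in> solid_slice2 t" "q$3 = t" "q$1 = l * p$1" "q$2 = l * p$2" "0 \<le> l" "l \<le> 1" "0 \<le> t"
  shows "q \<in> solid_slice2 t"
proof (cases "\<bar>p$2\<bar> \<le> p$1")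
  case True
  then have "l * \<bar>p$2\<bar> \<le> l * p$1"
    using assms by (intro mult_left_mono) auto
  moreover have "l * p$1 \<le> 1 * t^2"
    using assms True by (intro mult_mono) (auto simp: solid_slice2_def)
  ultimately show ?thesis
    using assms True by (auto simp: solid_slice2_def abs_mult)
next
  case False
  then have p: "p$2 = 0" "- (t^3) \<le> p$1" "p$1 \<le> 0"
    using assms by (auto simp: solid_slice2_def)
  have "l * (- p$1) \<le> 1 * t^3"
    using assms p by (intro mult_mono) auto
  then show ?thesis
    using assms p by (auto simp: solid_slice2_def mult_nonneg_nonpos)
qed

text \<open>A point of the face \<open>x = z^2\<close> is pushed outwards in \<open>x\<close>; any
  other point lies on a side face or on the hair and leaves the filled slice when moved in
  \<open>y\<close> away from \<open>y = 0\<close>.\<close>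

lemma X2_frontier_point:
  assumes y: "y \<in> X2" and t: "0 < y$3" and e: "0 < e"
  obtains q where "q$3 = y$3" "q \<notin> solid_slice2 (y$3)" "\<bar>q$1 - y$1\<bar> \<le> e" "\<bar>q$2 - y$2\<bar> \<le> e"
    "dist q y \<le> 2 * e"
proof -
  define q :: "real^3" where
    "q = (if y \<in> triangle_horn_boundary \<and> y$1 = (y$3)^2 then vector [y$1 + e, y$2, y$3]
          else vector [y$1, (if y$2 \<ge> 0 then y$2 + e else y$2 - e), y$3])"
  have "q$3 = y$3" "q \<notin> solid_slice2 (y$3)" "\<bar>q$1 - y$1\<bar> \<le> e" "\<bar>q$2 - y$2\<bar> \<le> e"
    using assms by (auto simp: q_def solid_slice2_def mem_X2 triangle_horn_boundary_def)
  moreover have "dist q y \<le> 2 * e"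
    using norm_real3_le[of "q - y"] calculation by (simp add: dist_norm)
  ultimately show ?thesis
    using that by blast
qed

text \<open>Below height 1 the surface contains the whole boundary of the solid horn, so the inside
  and the outside are open sets separating its complement.\<close>

lemma connected_avoiding_X1:
  assumes S: "connected S" "S \<inter> X1 = {}" "\<And>p. p \<in> S \<Longrightarrow> p$3 < 1"
    and p: "p \<in> S" "0 < p$3" "\<bar>p$2\<bar> < p$1" "p$1 < (p$3)^2"
    and q: "q \<in> S"
  shows "0 < q$3 \<and> \<bar>q$2\<bar> < q$1 \<and> q$1 < (q$3)^2"
proof -
  define I where "I = {p :: real^3. 0 < p$3} \<inter> {p. \<bar>p$2\<bar> < p$1} \<inter> {p. p$1 < (p$3)^2}"
  define E where "E = - ({p :: real^3. 0 \<le> p$3} \<inter> {p. \<bar>p$2\<bar> \<le> p$1} \<inter> {p. p$1 \<le> (p$3)^2})"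
  have "open I"
    unfolding I_def by (intro open_Int open_Collect_less continuous_intros)
  moreover have "open E"
    unfolding E_def by (intro open_Compl closed_Int closed_Collect_le continuous_intros)
  moreover have "S \<subseteq> I \<union> E"
  proof
    fix x assume "x \<in> S"
    then have "x \<notin> X1" "x$3 < 1"
      using S by auto
    then show "x \<in> I \<union> E"
      by (cases "x$3 = 0") (auto simp: I_def E_def mem_X1 triangle_horn_boundary_def)
  qed
  moreover have "I \<inter> E \<inter> S = {}"
    by (auto simp: I_def E_def)
  moreover have "p \<in> I \<inter> S"
    using p by (auto simp: I_def)
  ultimately have "E \<inter> S = {}"
    using S(1) unfolding connected_def by blast
  with \<open>S \<subseteq> I \<union> E\<close> q have "q \<in> I"
    by blast
  then show ?thesis
    by (auto simp: I_def)
qed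

lemma X2_flat:
  assumes "p \<in> X2"
  shows "0 \<le> p$3" "p$3 < 1" "\<bar>p$1\<bar> \<le> (p$3)^2" "\<bar>p$2\<bar> \<le> (p$3)^2"
proof -
  show "0 \<le> p$3" "p$3 < 1"
    using assms by (auto simp: mem_X2)
  then have "(p$3)^3 \<le> (p$3)^2"
    by (intro power_decreasing) auto
  then show "\<bar>p$1\<bar> \<le> (p$3)^2" "\<bar>p$2\<bar> \<le> (p$3)^2"
    using assms by (auto simp: mem_X2 triangle_horn_boundary_def)
qed

text \<open>
  A point at height \<open>t\<close> and horizontal distance \<open>t\<close> from the axis is at distance of order \<open>t\<close> from
  \<open>X2\<close>, whereas every point of the solid horn is within order \<open>t\<^sup>2\<close> of \<open>X1\<close>: so \<open>k\<close>
  cannot take the former into the latter.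
\<close>

lemma lipschitz_image_not_in_horn:
  assumes h: "M-lipschitz_on U h" and hk: "\<And>x. x \<in> V \<Longrightarrow> k x \<in> U \<and> h (k x) = x"
    and hX: "h ` (X1 \<inter> U) \<subseteq> X2" and M: "1 \<le> M"
    and ball: "ball 0 \<epsilon> \<subseteq> U" and \<epsilon>: "\<epsilon> \<le> 1"
    and q: "q \<in> V" "q$3 = t" "\<bar>q$1\<bar> = t \<or> \<bar>q$2\<bar> = t"
    and t: "0 < t" "3 * M * t < \<epsilon>" "t * (18 * M^3 + 4) < 1"
    and kq: "norm (k q) \<le> 3 * M * t" "0 < k q $ 3" "\<bar>k q $ 2\<bar> < k q $ 1" "k q $ 1 < (k q $ 3)^2"
  shows False
proof -
  \<comment> \<open>The axis point level with \<open>k q\<close>; it belongs to \<open>X1\<close>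
    and is within quadratic distance of \<open>k q\<close>.\<close>
  define a :: "real^3" where "a = vector [0, 0, k q $ 3]"
  have k3: "k q $ 3 \<le> 3 * M * t"
    using kq(1) component_le_norm_cart[of "k q" 3] by linarith
  have "norm a \<le> k q $ 3"
    using norm_real3_le[of a] kq(2) by (simp add: a_def)
  then have aU: "a \<in> U"
    using ball t k3 by auto
  have "a \<in> X1"
    using kq(2) k3 t \<epsilon> by (auto simp: a_def mem_X1)
  then have ha: "h a \<in> X2"
    using hX aU by blast
  have "dist (k q) a \<le> 2 * (k q $ 3)^2"
    using norm_real3_le[of "k q - a"] kq by (simp add: a_def dist_norm)
  also have "\<dots> \<le> 2 * (3 * M * t)^2"
    using k3 kq by (intro mult_left_mono power_mono) auto
  finally have d: "dist (k q) a \<le> 2 * (3 * M * t)^2" .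
  have "dist q (h a) = dist (h (k q)) (h a)"
    using hk q by simp
  also have "\<dots> \<le> M * dist (k q) a"
    using hk q aU by (intro lipschitz_onD[OF h]) auto
  also have "\<dots> \<le> M * (2 * (3 * M * t)^2)"
    using d M by (intro mult_left_mono) auto
  also have "\<dots> = t * (t * (18 * M^3))"
    by (simp add: power2_eq_square power3_eq_cube)
  finally have d: "dist q (h a) \<le> t * (t * (18 * M^3))" .
  \<comment> \<open>Hence \<open>q\<close> is closer than \<open>t - 4 * t^2\<close> to
    \<open>h a\<close>. So \<open>h a\<close> has height at most \<open>2 * t\<close> and horizontal
    coordinates at most \<open>4 * t^2\<close>, while one of those of \<open>q\<close> has absolute
    value \<open>t\<close>.\<close>
  have lt: "t * (t * (18 * M^3 + 4)) < t * 1"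
    using t by (intro mult_strict_left_mono) auto
  then have lt': "t * (t * (18 * M^3)) < t - 4 * t^2"
    by (simp add: algebra_simps power2_eq_square)
  have "h a $ 3 \<le> 2 * t"
    using component_le_dist[of q 3 "h a"] d lt' q t zero_le_power2[of t] by linarith
  then have "(h a $ 3)^2 \<le> (2 * t)^2"
    using X2_flat[OF ha] by (intro power_mono) auto
  then show False
    using X2_flat[OF ha] component_le_dist[of q 1 "h a"] component_le_dist[of q 2 "h a"] d lt' q t
    by (auto simp: power_mult_distrib)
qed

lemma X1_not_ambient_bilipschitz_equivalent_X2: "\<not> ambient_bilipschitz_equivalent X1 X2"
proof
  assume "ambient_bilipschitz_equivalent X1 X2"
  then obtain U V h k K L where UV: "open U" "0 \<in> U" "open V" "0 \<in> V"
    and hom: "homeomorphism U V h k" and K: "K-lipschitz_on U h" and L: "L-lipschitz_on V k"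
    and h0: "h 0 = 0" and hX: "h ` (X1 \<inter> U) = X2 \<inter> V"
    unfolding ambient_bilipschitz_equivalent_def bilipschitz_homeomorphism_def by blast
  define M where "M = max 1 (max K L)"
  have M: "1 \<le> M" and lh: "M-lipschitz_on U h" and lk: "M-lipschitz_on V k"
    using lipschitz_on_le[OF K, of M] lipschitz_on_le[OF L, of M] by (auto simp: M_def)
  have kh: "x \<in> U \<Longrightarrow> h x \<in> V \<and> k (h x) = x" and hk: "x \<in> V \<Longrightarrow> k x \<in> U \<and> h (k x) = x" for x
    using hom by (auto simp: homeomorphism_def)
  have k0: "k 0 = 0"
    using kh[OF UV(2)] h0 by simp
  have nh: "norm (h x) \<le> M * norm x" if "x \<in> U" for x
    using lipschitz_onD[OF lh that UV(2)] h0 by simp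
  have nk: "norm (k x) \<le> M * norm x" if "x \<in> V" for x
    using lipschitz_onD[OF lk that UV(4)] k0 by simp
  obtain e where e: "0 < e" "ball 0 e \<subseteq> U \<inter> V"
    using open_contains_ball[of "U \<inter> V"] UV by blast
  define \<epsilon> where "\<epsilon> = min e 1"
  have \<epsilon>: "0 < \<epsilon>" "\<epsilon> \<le> 1" "ball 0 \<epsilon> \<subseteq> U" "ball 0 \<epsilon> \<subseteq> V"
    using e by (auto simp: \<epsilon>_def)
  \<comment> \<open>Chosen so that every \<open>t < \<delta>\<close> satisfies both smallness
    hypotheses of \<open>lipschitz_image_not_in_horn\<close>.\<close>
  define \<delta> where "\<delta> = min (\<epsilon> / (3 * M)) (1 / (18 * M^3 + 4))"
  have M3: "0 < 18 * M^3 + 4"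
    using M by (simp add: add_nonneg_pos)
  have \<delta>: "0 < \<delta>" "3 * M * \<delta> \<le> \<epsilon>" "\<delta> * (18 * M^3 + 4) \<le> 1"
    using \<epsilon> M M3 by (auto simp: \<delta>_def min_def field_simps)
  \<comment> \<open>The point \<open>x\<close> below has norm at most \<open>2 * s\<close>, so its
    image has height at most \<open>2 * M * s < \<delta>\<close>.\<close>
  define s where "s = \<delta> / (4 * M)"
  have s: "0 < s" "2 * M * s < \<delta>"
    using \<delta> M by (auto simp: s_def)
  have "1 * s \<le> M * s" "1 * \<delta> \<le> M * \<delta>"
    using M s \<delta> by (auto intro!: mult_right_mono)
  then have s1: "2 * s < \<epsilon>"
    using s \<delta> by linarith
  then have s2: "s < 1"
    using s \<epsilon> by linarith
  \<comment> \<open>The midpoint of the hair of \<open>X1\<close> at height \<open>s\<close>,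
    strictly inside the horn.\<close>
  define x :: "real^3" where "x = vector [s^3 / 2, 0, s]"
  have s3: "s^3 \<le> s" "s^3 \<le> s^2"
    using s s2 power_decreasing[of 1 3 s] power_decreasing[of 2 3 s] by auto
  have "s^3 < s^2 * 2"
    using s3(2) zero_less_power[OF s(1), of 2] by linarith
  have nx: "norm x \<le> 2 * s"
    using norm_real3_le[of x] s s3 by (simp add: x_def)
  then have xU: "x \<in> U"
    using s1 \<epsilon> by auto
  have "x \<in> X1"
    using s s2 by (simp add: x_def mem_X1)
  define y where "y = h x"
  have y: "y \<in> X2" "y \<in> V" "k y = x"
    using hX xU \<open>x \<in> X1\<close> kh by (auto simp: y_def)
  define t where "t = y$3"
  have "x \<noteq> 0"
    using s by (auto simp: x_def eq_0_real3_iff)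
  then have "y \<noteq> 0"
    using y k0 by auto
  then have t0: "0 < t"
    using X2_flat[OF y(1)] by (cases "t = 0") (auto simp: t_def eq_0_real3_iff)
  have "t \<le> norm y"
    using component_le_norm_cart[of y 3] by (simp add: t_def)
  also have "\<dots> \<le> M * norm x"
    using nh xU by (simp add: y_def)
  also have "\<dots> \<le> M * (2 * s)"
    using nx M by (intro mult_left_mono) auto
  finally have t1: "t < \<delta>"
    using s by simp
  have "M * t < M * \<delta>"
    using t1 M by simp
  then have t2: "3 * M * t < \<epsilon>"
    using \<delta> by linarith
  have "t * (18 * M^3 + 4) < \<delta> * (18 * M^3 + 4)"
    using t1 M3 by simp
  then have t3: "t * (18 * M^3 + 4) < 1"
    using \<delta> by linarith
  have "t * 4 \<le> t * (18 * M^3 + 4)"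
    using t0 M by (intro mult_left_mono) auto
  then have t4: "t < 1/4"
    using t3 by linarith
  define I where "I = {p :: real^3. 0 < p$3} \<inter> {p. \<bar>p$2\<bar> < p$1} \<inter> {p. p$1 < (p$3)^2}"
  have "open I"
    unfolding I_def by (intro open_Int open_Collect_less continuous_intros)
  have "k y \<in> I"
    using s \<open>s^3 < s^2 * 2\<close> by (auto simp: I_def y x_def)
  moreover have "continuous_on V k"
    using hom by (simp add: homeomorphism_def)
  ultimately have W: "open (V \<inter> k -` I)" "y \<in> V \<inter> k -` I"
    using continuous_open_preimage[OF _ UV(3) \<open>open I\<close>, of k] y by (simp_all add: Int_commute)
  then obtain r where r: "0 < r" "ball y r \<subseteq> V \<inter> k -` I"
    using open_contains_ball by metis
  \<comment> \<open>The first bound keeps \<open>q\<close> in the ball that \<open>k\<close> maps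
    into the open horn; the second keeps its horizontal coordinates below \<open>t\<close>.\<close>
  define \<eta> where "\<eta> = min (r / 4) (t^2)"
  have \<eta>: "0 < \<eta>" "\<eta> \<le> t^2" "2 * \<eta> < r"
    using r t0 by (auto simp: \<eta>_def)
  obtain q where q: "q$3 = t" "q \<notin> solid_slice2 t" "\<bar>q$1 - y$1\<bar> \<le> \<eta>" "\<bar>q$2 - y$2\<bar> \<le> \<eta>"
    "dist q y \<le> 2 * \<eta>"
    using X2_frontier_point[OF y(1) t0[unfolded t_def] \<eta>(1), folded t_def] .
  have "q \<in> ball y r"
    using q \<eta> by (simp add: dist_commute)
  then have kq: "k q \<in> I"
    using r by blast
  define m where "m = max \<bar>q$1\<bar> \<bar>q$2\<bar>"
  have "t^2 \<le> t / 4"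
    using t0 t4 by (simp add: power2_eq_square)
  then have "m \<le> t"
    using X2_flat[OF y(1)] q \<eta> by (auto simp: m_def t_def)
  moreover have "0 < m"
  proof (rule ccontr)
    assume "\<not> 0 < m"
    then have "q$1 = 0" "q$2 = 0"
      by (auto simp: m_def)
    with q t0 show False
      by (auto simp: solid_slice2_def)
  qed
  ultimately have m: "0 < m" "m \<le> t"
    by simp_all
  \<comment> \<open>The radial push of \<open>q\<close> away from the axis until its larger
    horizontal coordinate has absolute value \<open>t\<close>.\<close>
  define q' :: "real^3" where "q' = vector [t / m * q$1, t / m * q$2, t]"
  have mt: "1 \<le> t / m" "t / m * m = t"
    using m by auto
  define S where "S = closed_segment q q'"
  have S: "p$3 = t \<and> p \<notin> solid_slice2 t \<and> norm p \<le> 3 * t" if pS: "p \<in> S" for p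
  proof -
    obtain u where u: "0 \<le> u" "u \<le> 1" and p: "p$1 = (1 - u) * q$1 + u * q'$1"
      "p$2 = (1 - u) * q$2 + u * q'$2" "p$3 = (1 - u) * q$3 + u * q'$3"
      using pS unfolding S_def mem_closed_segment_3 by blast
    \<comment> \<open>Points of the segment are \<open>q\<close> scaled horizontally by
      \<open>l \<ge> 1\<close>; if one were in the filled slice, shrinking by \<open>1 / l\<close>
      would put \<open>q\<close> there too.\<close>
    define l where "l = 1 + u * (t / m - 1)"
    have l: "1 \<le> l" "l \<le> t / m"
      using u mt(1) mult_right_mono[of u 1 "t / m - 1"] by (simp_all add: l_def)
    have p': "p$1 = l * q$1" "p$2 = l * q$2" "p$3 = t"
      by (simp_all add: p l_def q'_def q(1) algebra_simps)
    have notin: "p \<notin> solid_slice2 t"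
    proof
      assume "p \<in> solid_slice2 t"
      moreover have "q$1 = 1 / l * p$1" "q$2 = 1 / l * p$2" "0 \<le> 1 / l" "1 / l \<le> 1"
        using l p' by simp_all
      ultimately show False
        using solid_slice2_shrink[of p t q "1 / l"] q(1,2) t0 by simp
    qed
    have "l * m \<le> t"
      using l m mt(2) mult_right_mono[of l "t / m" m] by linarith
    moreover have "l * \<bar>q$1\<bar> \<le> l * m" "l * \<bar>q$2\<bar> \<le> l * m"
      using l by (intro mult_left_mono; simp add: m_def)+
    ultimately have "l * \<bar>q$1\<bar> \<le> t" "l * \<bar>q$2\<bar> \<le> t"
      by linarith+
    then have "\<bar>p$1\<bar> \<le> t" "\<bar>p$2\<bar> \<le> t"
      using l by (simp_all add: p' abs_mult)
    then have "norm p \<le> 3 * t"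
      using norm_real3_le[of p] p' t0 by simp
    with notin show ?thesis
      using p' by simp
  qed
  have "1 * t \<le> M * t"
    using M t0 by (intro mult_right_mono) auto
  then have "3 * t < \<epsilon>"
    using t2 by linarith
  have SV: "S \<subseteq> V"
  proof
    fix p assume "p \<in> S"
    then have "norm p < \<epsilon>"
      using S[of p] \<open>3 * t < \<epsilon>\<close> by linarith
    then show "p \<in> V"
      using \<epsilon>(4) by auto
  qed
  have nkS: "norm (k p) \<le> 3 * M * t" if "p \<in> S" for p
  proof -
    have "norm (k p) \<le> M * norm p"
      using nk SV that by blast
    also have "\<dots> \<le> M * (3 * t)"
      using S[OF that] M by (intro mult_left_mono) auto
    finally show ?thesis
      by simp
  qed
  \<comment> \<open>The image of the segment starts inside the horn and never meets
    \<open>X1\<close>, so its other end \<open>k q'\<close> is inside as well.\<close>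
  have "connected (k ` S)"
    using \<open>continuous_on V k\<close> SV
    by (intro connected_continuous_image) (auto simp: S_def intro: continuous_on_subset)
  moreover have "k ` S \<inter> X1 = {}"
  proof (intro equals0I)
    fix z assume "z \<in> k ` S \<inter> X1"
    then obtain p where p: "p \<in> S" "k p \<in> X1"
      by blast
    then have "h (k p) \<in> X2"
      using hX hk SV by blast
    then have "p \<in> X2"
      using hk SV p by auto
    with S[OF p(1)] X2_subset_solid_slice2[of p] show False
      by auto
  qed
  moreover have "z$3 < 1" if "z \<in> k ` S" for z
  proof -
    have "norm z \<le> 3 * M * t"
      using that nkS by blast
    then show ?thesis
      using component_le_norm_cart[of z 3] t2 \<epsilon>(2) by linarith
  qed
  moreover have "q \<in> S" "q' \<in> S"
    by (auto simp: S_def)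
  ultimately have kq': "0 < k q' $ 3" "\<bar>k q' $ 2\<bar> < k q' $ 1" "k q' $ 1 < (k q' $ 3)^2"
    using connected_avoiding_X1[of "k ` S" "k q" "k q'"] kq by (auto simp: I_def)
  have "\<bar>q'$1\<bar> = t / m * \<bar>q$1\<bar>" "\<bar>q'$2\<bar> = t / m * \<bar>q$2\<bar>"
    using t0 m by (auto simp: q'_def abs_mult)
  then have "\<bar>q'$1\<bar> = t \<or> \<bar>q'$2\<bar> = t"
    using mt by (auto simp: m_def max_def split: if_splits)
  moreover have "q' \<in> V" "q'$3 = t" "norm (k q') \<le> 3 * M * t" "h ` (X1 \<inter> U) \<subseteq> X2"
    using \<open>q' \<in> S\<close> SV nkS hX by (auto simp: q'_def)
  ultimately show False
    using lipschitz_image_not_in_horn[OF lh hk _ M \<epsilon>(3,2) _ _ _ t0 t2 t3 _ kq'] by simp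
qed

theorem proposition11p13:
  "ambient_topologically_equivalent X1 X2 \<and>
   outer_bilipschitz_equivalent X1 X2 \<and>
   \<not> ambient_bilipschitz_equivalent X1 X2"
  using X1_ambient_topologically_equivalent_X2 X1_outer_bilipschitz_equivalent_X2
    X1_not_ambient_bilipschitz_equivalent_X2 by blast

end
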